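(* Let $L_0>0$, $L_1\ge 0$ and $\ell(s)=L_0+L_1 s$. Let $f:\mathbb{R}^d\to\mathbb{R}\cup\{\infty\}$ be convex and $\ell$-smooth (that is, $(L_0,L_1)$-smooth), attaining its minimum at $x^*\in\mathbb{R}^d$, and let $x^0\in\mathcal{X}$, $x^0\ne x^*$, $R:=\|x^0-x^*\|$. Let $\Gamma_0>0$ satisfy $\Gamma_0\ge\frac{2(f(x^0)-f(x^* ))}{\|x^0-x^*\|^2}$, let $\bar R\ge R$, and let $\varepsilon>0$. Then the oracle complexity (number of gradient calls) required by Algorithm 2 with parameters $\Gamma_0,\bar R$ to find an $\varepsilon$-solution is $$\mathcal{O}\left(\frac{\sqrt{L_0}\,R}{\sqrt{\varepsilon}}+\max\left\{L_1\bar R\,\log\left(\min\left\{\frac{L_1^2\bar R^2\Gamma_0}{L_0},\frac{\Gamma_0R^2}{\varepsilon}\right\}\right),0\right\}+\max\left\{\log\left(\frac{\Gamma_0}{L_0}\right),0\right\}\right),$$ where $\mathcal{O}$ hides only a universal constant.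
   Context: $\|\cdot\|$ is the Euclidean norm for vectors and the spectral norm for matrices; $\mathbb{R}_+=[0,\infty)$. An $\varepsilon$-solution is a point $\bar x\in\mathbb{R}^d$ with $f(\bar x)-\inf_{x} f(x)\le\varepsilon$. When $L_1=0$, the term $\max\{L_1\bar R\log(\cdot),0\}$ is read as $0$. Setting: $f:\mathbb{R}^d\to\mathbb{R}\cup\{\infty\}$, $\mathcal{X}:=\{x\in\mathbb{R}^d: f(x)<\infty\}$ is assumed to be an open, $d$-dimensional (nonempty) convex set, and $\bar{\mathcal{X}}$ denotes its closure; $\mathrm{Proj}_{\bar{\mathcal{X}}}$ is the Euclidean projection onto $\bar{\mathcal{X}}$. $f$ is $\ell$-smooth with $\ell(s)=L_0+L_1s$ if $f$ is twice differentiable on $\mathcal{X}$, continuous on $\bar{\mathcal{X}}$, and $\|\nabla^2 f(x)\|\le L_0+L_1\|\nabla f(x)\|$ for all $x\in\mathcal{X}$. Algorithm 2 (input: $x^0\in\mathcal{X}$, $\ell$, $\Gamma_0$, $\bar R$). Let $\psi(x)=\frac{x^2}{2\ell(4x)}$ on $\mathbb{R}_+$ and let $\psi^{-1}$ be its inverse. Set $y^0=u^0=x^0$ and for $k=0,1,2,\dots$: $\gamma_k=1/\ell\left(4\psi^{-1}(\Gamma_k\bar R^2)\right)$; $\alpha_k=\sqrt{\gamma_k\Gamma_k}$; $y^{k+1}=\frac{1}{1+\alpha_k}y^k+\frac{\alpha_k}{1+\alpha_k}u^k-\frac{\gamma_k}{1+\alpha_k}\nabla f(y^k)$; $u^{k+1}=\mathrm{Proj}_{\bar{\mathcal{X}}}\left(u^k-\frac{\alpha_k}{\Gamma_k}\nabla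 f(y^{k+1})\right)$; $\Gamma_{k+1}=\Gamma_k/(1+\alpha_k)$. One new gradient is computed per iteration. *)

theory Defs
  imports "HOL-Analysis.Analysis"
begin

(* The constant hidden in an O-bound has to be chosen before the dimension d, and in HOL a
   quantifier over d cannot range over the types "real ^ 'n".  All the spaces R^d are therefore
   realised as subspaces of one inner product space: the finitely supported real sequences with
   the Euclidean inner product. *)

typedef evec = "{x :: nat \<Rightarrow> real. finite {i. x i \<noteq> 0}}"
  morphisms coord Abs_evec
  by (rule exI[of _ "\<lambda>_. 0"]) simp

setup_lifting type_definition_evec

lemma finite_coord: "finite {i. coord x i \<noteq> 0}"
  using coord[of x] by simp

lemma evec_eqI: "(\<And>i. coord x i = coord y i) \<Longrightarrow> x = y"
  by (metis coord_inject ext)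

instantiation evec :: real_vector
begin

lift_definition zero_evec :: evec is "\<lambda>_. 0"
  by simp

lift_definition plus_evec :: "evec \<Rightarrow> evec \<Rightarrow> evec" is "\<lambda>x y i. x i + y i"
  subgoal for x y
    by (rule finite_subset[of _ "{i. x i \<noteq> 0} \<union> {i. y i \<noteq> 0}"]) auto
  done

lift_definition minus_evec :: "evec \<Rightarrow> evec \<Rightarrow> evec" is "\<lambda>x y i. x i - y i"
  subgoal for x y
    by (rule finite_subset[of _ "{i. x i \<noteq> 0} \<union> {i. y i \<noteq> 0}"]) auto
  done

lift_definition uminus_evec :: "evec \<Rightarrow> evec" is "\<lambda>x i. - x i"
  by simp

lift_definition scaleR_evec :: "real \<Rightarrow> evec \<Rightarrow> evec" is "\<lambda>c x i. c * x i"
  subgoal for c x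
    by (rule finite_subset[of _ "{i. x i \<noteq> 0}"]) auto
  done

instance
  by (standard; transfer; auto simp: algebra_simps)

end

lemma coord_zero [simp]: "coord 0 i = 0"
  and coord_add [simp]: "coord (x + y) i = coord x i + coord y i"
  and coord_diff [simp]: "coord (x - y) i = coord x i - coord y i"
  and coord_uminus [simp]: "coord (- x) i = - coord x i"
  and coord_scaleR [simp]: "coord (c *\<^sub>R x) i = c * coord x i"
  by (simp_all add: zero_evec.rep_eq plus_evec.rep_eq minus_evec.rep_eq
      uminus_evec.rep_eq scaleR_evec.rep_eq)

instantiation evec :: real_inner
begin

definition inner_evec :: "evec \<Rightarrow> evec \<Rightarrow> real"
  where "inner_evec x y = (\<Sum>i | coord x i \<noteq> 0. coord x i * coord y i)"

definition norm_evec :: "evec \<Rightarrow> real"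
  where "norm_evec x = sqrt (inner x x)"

definition dist_evec :: "evec \<Rightarrow> evec \<Rightarrow> real"
  where "dist_evec x y = norm (x - y)"

definition sgn_evec :: "evec \<Rightarrow> evec"
  where "sgn_evec x = x /\<^sub>R norm x"

definition uniformity_evec :: "(evec \<times> evec) filter"
  where "uniformity_evec = (INF e\<in>{0<..}. principal {(x, y). dist x y < e})"

definition open_evec :: "evec set \<Rightarrow> bool"
  where "open_evec U \<longleftrightarrow> (\<forall>x\<in>U. eventually (\<lambda>(x', y). x' = x \<longrightarrow> y \<in> U) uniformity)"

lemma inner_evec_superset:
  assumes "finite A" "{i. coord x i \<noteq> 0} \<subseteq> A"
  shows "inner x y = (\<Sum>i\<in>A. coord x i * coord y i)"
  unfolding inner_evec_def using assms by (intro sum.mono_neutral_left) auto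

instance
proof
  fix x y z :: evec and r :: real
  show "dist x y = norm (x - y)"
    by (rule dist_evec_def)
  show "sgn x = x /\<^sub>R norm x"
    by (rule sgn_evec_def)
  show "uniformity = (INF e\<in>{0<..}. principal {(x :: evec, y). dist x y < e})"
    by (rule uniformity_evec_def)
  show "open U \<longleftrightarrow> (\<forall>x\<in>U. eventually (\<lambda>(x', y). x' = x \<longrightarrow> y \<in> U) uniformity)"
    for U :: "evec set"
    by (rule open_evec_def)
  show "norm x = sqrt (inner x x)"
    by (rule norm_evec_def)
  define A where
    "A = {i. coord x i \<noteq> 0} \<union> {i. coord y i \<noteq> 0} \<union> {i. coord z i \<noteq> 0}"
  have A: "finite A"
    unfolding A_def by (simp add: finite_coord)
  have S: "inner v w = (\<Sum>i\<in>A. coord v i * coord w i)" if "\<forall>i. i \<notin> A \<longrightarrow> coord v i = 0" for v w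
    using A that by (intro inner_evec_superset) auto
  have out: "coord x i = 0 \<and> coord y i = 0 \<and> coord z i = 0" if "i \<notin> A" for i
    using that by (auto simp: A_def)
  show "inner x y = inner y x"
    by (simp add: S out mult.commute)
  show "inner (x + y) z = inner x z + inner y z"
    by (simp add: S out algebra_simps sum.distrib)
  show "inner (r *\<^sub>R x) y = r * inner x y"
    by (simp add: S out sum_distrib_left mult.assoc)
  show "0 \<le> inner x x"
    unfolding inner_evec_def by (intro sum_nonneg) simp
  show "inner x x = 0 \<longleftrightarrow> x = 0"
  proof
    assume "inner x x = 0"
    then have "coord x i = 0" for i
      unfolding inner_evec_def by (subst (asm) sum_nonneg_eq_0_iff) (auto simp: finite_coord)
    then show "x = 0"
      by (intro evec_eqI) simp
  qed (simp add: inner_evec_def)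
qed

end

definition Rn :: "nat \<Rightarrow> evec set"
  where "Rn d = {x. \<forall>i\<ge>d. coord x i = 0}"

lemma inner_Rn: "x \<in> Rn d \<Longrightarrow> inner x y = (\<Sum>i<d. coord x i * coord y i)"
  by (rule inner_evec_superset) (auto simp: Rn_def not_le[symmetric])

lemma norm_Rn: "x \<in> Rn d \<Longrightarrow> norm x = sqrt (\<Sum>i<d. (coord x i)\<^sup>2)"
  by (simp add: norm_eq_sqrt_inner inner_Rn power2_eq_square)

lemma subspace_Rn: "subspace (Rn d)"
  by (auto simp: subspace_def Rn_def)

(* A function R^d -> R \<union> {\<infinity>} is an ereal-valued f of which only the values on Rn d matter. *)

definition edomain :: "nat \<Rightarrow> (evec \<Rightarrow> ereal) \<Rightarrow> evec set"
  where "edomain d f = {x \<in> Rn d. f x < \<infinity>}"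

definition proper_domain :: "nat \<Rightarrow> (evec \<Rightarrow> ereal) \<Rightarrow> bool"
  where "proper_domain d f \<longleftrightarrow>
    (\<forall>x\<in>Rn d. f x \<noteq> -\<infinity>) \<and>
    edomain d f \<noteq> {} \<and> convex (edomain d f) \<and> openin (top_of_set (Rn d)) (edomain d f)"

definition ext_convex :: "nat \<Rightarrow> (evec \<Rightarrow> ereal) \<Rightarrow> bool"
  where "ext_convex d f \<longleftrightarrow>
    (\<forall>x\<in>Rn d. \<forall>y\<in>Rn d. \<forall>t\<in>{0<..<1}.
       f ((1 - t) *\<^sub>R x + t *\<^sub>R y) \<le> ereal (1 - t) * f x + ereal t * f y)"

definition is_gradient :: "nat \<Rightarrow> (evec \<Rightarrow> ereal) \<Rightarrow> evec \<Rightarrow> evec \<Rightarrow> bool"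
  where "is_gradient d f x g \<longleftrightarrow>
    g \<in> Rn d \<and> ((\<lambda>z. real_of_ereal (f z)) has_derivative (\<lambda>h. inner g h)) (at x within Rn d)"

lemma is_gradient_unique:
  assumes "x \<in> Rn d" "is_gradient d f x g" "is_gradient d f x g'"
  shows "g = g'"
proof -
  define e where "e = g - g'"
  have e: "e \<in> Rn d"
    using assms subspace_Rn[of d] unfolding e_def is_gradient_def by (simp add: subspace_diff)
  have line: "((\<lambda>t::real. x + t *\<^sub>R e) has_derivative (\<lambda>t. t *\<^sub>R e)) (at 0)"
    by (auto intro!: derivative_eq_intros)
  have sub: "(\<lambda>t::real. x + t *\<^sub>R e) ` UNIV \<subseteq> Rn d"
    using e assms(1) subspace_Rn[of d] by (auto simp: subspace_add subspace_mul)
  have D: "((\<lambda>t::real. real_of_ereal (f (x + t *\<^sub>R e))) has_derivative (\<lambda>t. inner k (t *\<^sub>R e))) (at 0)"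
    if k: "is_gradient d f x k" for k
  proof -
    have "((\<lambda>z. real_of_ereal (f z)) has_derivative inner k)
        (at (x + 0 *\<^sub>R e) within (\<lambda>t::real. x + t *\<^sub>R e) ` UNIV)"
      using k sub unfolding is_gradient_def by (auto intro: has_derivative_subset)
    from has_derivative_in_compose[OF line this] show ?thesis by simp
  qed
  have "(\<lambda>t::real. inner g (t *\<^sub>R e)) = (\<lambda>t. inner g' (t *\<^sub>R e))"
    using has_derivative_unique[OF D[OF assms(2)] D[OF assms(3)]] .
  from fun_cong[OF this, of 1] have "inner e e = 0"
    by (simp add: e_def inner_diff_left)
  then show ?thesis
    by (simp add: e_def)
qed

definition grad :: "nat \<Rightarrow> (evec \<Rightarrow> ereal) \<Rightarrow> evec \<Rightarrow> evec"
  where "grad d f x = (SOME g. is_gradient d f x g)"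

definition hessian :: "nat \<Rightarrow> (evec \<Rightarrow> ereal) \<Rightarrow> evec \<Rightarrow> evec \<Rightarrow> evec"
  where "hessian d f x = frechet_derivative (grad d f) (at x within Rn d)"

(* The Hessian is determined on Rn d only, so its operator norm is taken over Rn d; onorm would
   range over all of evec. *)
definition spectral_norm :: "nat \<Rightarrow> (evec \<Rightarrow> evec) \<Rightarrow> real"
  where "spectral_norm d H = (SUP v\<in>{v \<in> Rn d. norm v = 1}. norm (H v))"

(* Continuity on the closure is that of ereal-valued functions, i.e. f tends to \<infinity> at boundary
   points of the (open) domain. *)
definition ell_smooth :: "nat \<Rightarrow> (evec \<Rightarrow> ereal) \<Rightarrow> (real \<Rightarrow> real) \<Rightarrow> bool"
  where "ell_smooth d f ell \<longleftrightarrow>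
    (\<forall>x\<in>edomain d f. \<exists>g. is_gradient d f x g) \<and>
    (\<forall>x\<in>edomain d f. grad d f differentiable (at x within Rn d)) \<and>
    continuous_on (closure (edomain d f)) f \<and>
    (\<forall>x\<in>edomain d f. spectral_norm d (hessian d f x) \<le> ell (norm (grad d f x)))"

(* closest_point from the library needs a Heine-Borel space, which evec is not; this is the same
   definition. *)
definition Proj :: "evec set \<Rightarrow> evec \<Rightarrow> evec"
  where "Proj S a = (SOME x. x \<in> S \<and> (\<forall>y\<in>S. dist a x \<le> dist a y))"

definition psi :: "(real \<Rightarrow> real) \<Rightarrow> real \<Rightarrow> real"
  where "psi ell x = x\<^sup>2 / (2 * ell (4 * x))"

definition psi_inv :: "(real \<Rightarrow> real) \<Rightarrow> real \<Rightarrow> real"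
  where "psi_inv ell = the_inv_into {0..} (psi ell)"

(* The state after k iterations is (y^k, u^k, Gamma_k). *)
primrec alg2 :: "nat \<Rightarrow> (evec \<Rightarrow> ereal) \<Rightarrow> (real \<Rightarrow> real) \<Rightarrow> real \<Rightarrow> real \<Rightarrow> evec \<Rightarrow> nat
    \<Rightarrow> evec \<times> evec \<times> real"
  where
    "alg2 d f ell \<Gamma>0 Rb x0 0 = (x0, x0, \<Gamma>0)"
  | "alg2 d f ell \<Gamma>0 Rb x0 (Suc k) =
      (let (y, u, \<Gamma>) = alg2 d f ell \<Gamma>0 Rb x0 k;
           \<gamma> = 1 / ell (4 * psi_inv ell (\<Gamma> * Rb\<^sup>2));
           \<alpha> = sqrt (\<gamma> * \<Gamma>);
           y' = (1 / (1 + \<alpha>)) *\<^sub>R y + (\<alpha> / (1 + \<alpha>)) *\<^sub>R u - (\<gamma> / (1 + \<alpha>)) *\<^sub>R grad d f y;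
           u' = Proj (closure (edomain d f)) (u - (\<alpha> / \<Gamma>) *\<^sub>R grad d f y')
       in (y', u', \<Gamma> / (1 + \<alpha>)))"

definition alg2_y :: "nat \<Rightarrow> (evec \<Rightarrow> ereal) \<Rightarrow> (real \<Rightarrow> real) \<Rightarrow> real \<Rightarrow> real \<Rightarrow> evec \<Rightarrow> nat \<Rightarrow> evec"
  where "alg2_y d f ell \<Gamma>0 Rb x0 k = fst (alg2 d f ell \<Gamma>0 Rb x0 k)"

definition eps_solution :: "nat \<Rightarrow> (evec \<Rightarrow> ereal) \<Rightarrow> real \<Rightarrow> evec \<Rightarrow> bool"
  where "eps_solution d f \<epsilon> x \<longleftrightarrow> x \<in> Rn d \<and> f x - (INF z\<in>Rn d. f z) \<le> ereal \<epsilon>"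

(* y^N is computed from the N gradients at y^0, ..., y^(N-1) and no others, so N counts the oracle
   calls.  The first conjunct makes these calls legitimate: each is at a point where f is
   differentiable, not where grad is an arbitrary value. *)
definition solves_with_calls ::
    "nat \<Rightarrow> (evec \<Rightarrow> ereal) \<Rightarrow> (real \<Rightarrow> real) \<Rightarrow> real \<Rightarrow> real \<Rightarrow> evec \<Rightarrow> real \<Rightarrow> nat \<Rightarrow> bool"
  where "solves_with_calls d f ell \<Gamma>0 Rb x0 \<epsilon> N \<longleftrightarrow>
    (\<forall>k<N. alg2_y d f ell \<Gamma>0 Rb x0 k \<in> edomain d f) \<and>
    eps_solution d f \<epsilon> (alg2_y d f ell \<Gamma>0 Rb x0 N)"

end

theory Submission
  imports Defs
begin

text \<open>
  Write \<open>\<ell>(s) = L\<^sub>0 + L\<^sub>1 s\<close>, and let \<open>\<psi>(M) = \<Gamma>\<^sub>k Rb\<^sup>2\<close>.  The Lyapunov function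
  \<open>V\<^sub>k = f(y\<^sub>k) - f(x\<^sup>*) + \<Gamma>\<^sub>k/2 \<parallel>u\<^sub>k - x\<^sup>*\<parallel>\<^sup>2\<close> satisfies \<open>V\<^sub>k\<^sub>+\<^sub>1 \<le> V\<^sub>k / (1 + \<alpha>\<^sub>k)\<close>,
  hence \<open>V\<^sub>k \<le> \<Gamma>\<^sub>k R\<^sup>2\<close>, as soon as the gradients at \<open>y\<^sub>k\<close> and \<open>y\<^sub>k\<^sub>+\<^sub>1\<close> are at most \<open>M\<close>
  and \<open>3M/2\<close>: then \<open>f\<close> is effectively \<open>\<ell>(4M)\<close>-smooth between them.  The bound at \<open>y\<^sub>k\<close> follows
  from \<open>\<psi>(\<parallel>\<nabla>f(y)\<parallel>) \<le> f(y) - f(x\<^sup>*)\<close>.  For \<open>y\<^sub>k\<^sub>+\<^sub>1\<close> let the step size grow from \<open>0\<close> to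
  \<open>\<gamma>\<^sub>k\<close>: while the gradient is at most \<open>3M/2\<close>, the decrease of the Lyapunov function bounds it
  by \<open>M\<close>, so by continuity it never exceeds \<open>M\<close>.  Finally \<open>\<alpha>\<^sub>k \<ge> 1 / (7(\<surd>(L\<^sub>0/\<Gamma>\<^sub>k) + L\<^sub>1 Rb))\<close>, and with
  \<open>B = L\<^sub>1 Rb\<close> the potential \<open>(B + 1) ln \<Gamma>\<^sub>k - 2\<surd>(L\<^sub>0/\<Gamma>\<^sub>k)\<close> drops by at least \<open>1/7\<close> in every step.
\<close>

section \<open>Topology of \<open>Rn d\<close> and the Euclidean projection\<close>

lemma continuous_on_coord: "continuous_on S (\<lambda>x. coord x i)"
proof -
  define e where "e = Abs_evec (\<lambda>j. if j = i then 1 else 0)"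
  have e: "coord e = (\<lambda>j. if j = i then 1 else 0)"
    unfolding e_def by (rule Abs_evec_inverse) simp
  have "coord x i = inner e x" for x
    by (subst inner_evec_superset[of "{i}"]) (auto simp: e)
  then show ?thesis by (simp add: continuous_intros)
qed

lemma closed_Rn: "closed (Rn d)"
proof -
  have "Rn d = (\<Inter>i\<in>{d..}. {x. coord x i = 0})"
    by (auto simp: Rn_def)
  moreover have "closed {x. coord x i = 0}" for i
    by (intro closed_Collect_eq continuous_on_coord continuous_on_const)
  ultimately show ?thesis by auto
qed

text \<open>\<open>evec\<close> is infinite-dimensional, so compactness must come from the first
  \<open>d\<close> coordinates: the ball is a closed subset of the continuous image of a cube,
  compact by Tychonoff.\<close>

lemma compact_Rn_cball: "compact (Rn d \<inter> cball 0 r)"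
proof -
  define e where "e i = Abs_evec (\<lambda>j. if j = i then 1 else 0)" for i :: nat
  have e: "coord (e i) = (\<lambda>j. if j = i then 1 else 0)" for i
    unfolding e_def by (rule Abs_evec_inverse) simp
  define \<phi> :: "(nat \<Rightarrow> real) \<Rightarrow> evec" where "\<phi> c = (\<Sum>i<d. c i *\<^sub>R e i)" for c
  define K where "K = (PiE UNIV (\<lambda>_. {-r..r}) :: (nat \<Rightarrow> real) set)"
  have "compact K"
    unfolding K_def compactin_euclidean_iff[symmetric] euclidean_product_topology[symmetric]
      compactin_PiE by (auto simp: compactin_euclidean_iff)
  moreover have "continuous_on K \<phi>"
    unfolding \<phi>_def by (intro continuous_intros continuous_on_subset[OF continuous_on_product_coordinates]) auto
  ultimately have "compact (\<phi> ` K)"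
    by (rule compact_continuous_image[rotated])
  moreover have "Rn d \<inter> cball 0 r \<subseteq> \<phi> ` K"
  proof
    fix x assume x: "x \<in> Rn d \<inter> cball 0 r"
    have sum: "coord (sum g A) i = (\<Sum>j\<in>A. coord (g j) i)" for g i and A :: "nat set"
      by (induction A rule: infinite_finite_induct) auto
    have "x = \<phi> (coord x)"
      using x by (intro evec_eqI) (auto simp: \<phi>_def sum e Rn_def if_distrib[of "\<lambda>b. a * b" for a] cong: if_cong)
    moreover have "\<bar>coord x i\<bar> \<le> r" for i
    proof (cases "i < d")
      case True
      have "(coord x i)\<^sup>2 \<le> (\<Sum>i<d. (coord x i)\<^sup>2)"
        using True by (intro member_le_sum) auto
      then have "\<bar>coord x i\<bar> \<le> norm x"
        using x real_sqrt_le_mono[of "(coord x i)\<^sup>2"] by (auto simp: norm_Rn[of x d])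
      then show ?thesis using x by simp
    next
      case False
      then show ?thesis using x by (auto simp: Rn_def order_trans[OF norm_ge_zero])
    qed
    then have "coord x \<in> K"
      by (auto simp: K_def abs_le_iff minus_le_iff)
    ultimately show "x \<in> \<phi> ` K" by blast
  qed
  ultimately show ?thesis
    by (metis closed_Int closed_Rn closed_cball compact_Int_closed inf.absorb_iff2)
qed

text \<open>Justifies the \<open>SOME\<close> in \<open>Proj\<close>: a minimiser can be sought
  among the points of \<open>S\<close> no farther from \<open>a\<close> than a fixed
  \<open>b\<close>, and these form a compact set.\<close>

lemma Proj_closest:
  assumes "closed S" "S \<noteq> {}" "S \<subseteq> Rn d"
  shows "Proj S a \<in> S" "y \<in> S \<Longrightarrow> dist a (Proj S a) \<le> dist a y"
proof -
  obtain b where b: "b \<in> S" using assms by auto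
  define r where "r = norm a + dist a b"
  define T where "T = S \<inter> cball a (dist a b)"
  have "norm x \<le> r" if "dist a x \<le> dist a b" for x
    using that norm_triangle_ineq2[of x a] by (simp add: r_def dist_norm norm_minus_commute)
  then have "T = (Rn d \<inter> cball 0 r) \<inter> T"
    using assms(3) by (auto simp: T_def)
  moreover have "closed T" using assms by (auto simp: T_def)
  ultimately have "compact T"
    by (metis compact_Int_closed compact_Rn_cball)
  moreover have "b \<in> T" using b by (simp add: T_def)
  moreover have "continuous_on T (dist a)" by (intro continuous_intros)
  ultimately obtain x where x: "x \<in> T" "\<And>y. y \<in> T \<Longrightarrow> dist a x \<le> dist a y"
    using continuous_attains_inf[of T "dist a"] by auto
  have "x \<in> S \<and> (\<forall>y\<in>S. dist a x \<le> dist a y)"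
    using x x(2)[OF \<open>b \<in> T\<close>] by (force simp: T_def)
  then have "Proj S a \<in> S \<and> (\<forall>y\<in>S. dist a (Proj S a) \<le> dist a y)"
    unfolding Proj_def by (rule someI)
  then show "Proj S a \<in> S" "y \<in> S \<Longrightarrow> dist a (Proj S a) \<le> dist a y" by auto
qed

text \<open>Seen from the projection, \<open>a\<close> and \<open>x\<close> enclose a non-acute
  angle; expand the squared distance around it.\<close>

lemma dist_Proj_le:
  assumes "closed S" "convex S" "S \<subseteq> Rn d" "x \<in> S"
  shows "dist (Proj S a) x \<le> dist a x"
proof -
  have ne: "S \<noteq> {}" using assms by auto
  note P = Proj_closest[OF assms(1) ne assms(3)]
  have "inner (a - Proj S a) (x - Proj S a) \<le> 0"
    using any_closest_point_dot[OF assms(2,1) P(1) assms(4)] P(2) by blast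
  then show ?thesis
    unfolding dist_norm norm_le
    using inner_ge_zero[of "a - Proj S a"] by (simp add: algebra_simps inner_commute)
qed

text \<open>Needed because a projected \<open>u\<close> may lie on the boundary of the domain.
  Replace \<open>u\<close> by a nearby \<open>u'\<close> in \<open>S\<close> and shift
  \<open>w\<close> to \<open>w'\<close> so that the combination is unchanged; relative openness
  keeps \<open>w'\<close> in \<open>S\<close>.\<close>

lemma openin_convex_shrink:
  fixes S T :: "'a::real_normed_vector set"
  assumes "convex S" "openin (top_of_set T) S" "subspace T" "closed T"
    and w: "w \<in> S" and u: "u \<in> closure S" and t: "0 \<le> t" "t < 1"
  shows "(1 - t) *\<^sub>R w + t *\<^sub>R u \<in> S"
proof (cases "t = 0")
  case False
  then have t0: "t > 0" using t by simp
  have ST: "S \<subseteq> T" using assms(2) openin_imp_subset by blast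
  obtain r where r: "r > 0" "ball w r \<inter> T \<subseteq> S"
    using assms(2) w by (auto simp: openin_contains_ball)
  have uT: "u \<in> T" using u ST \<open>closed T\<close> closure_minimal by blast
  have "(1 - t) / t * r > 0" using t0 t r by simp
  then obtain u' where u': "u' \<in> S" "dist u' u < (1 - t) / t * r"
    using u by (meson closure_approachable)
  define w' where "w' = w + (t / (1 - t)) *\<^sub>R (u - u')"
  have "dist w w' = t / (1 - t) * dist u' u"
    using t t0 by (simp add: w'_def dist_norm norm_minus_commute)
  also have "\<dots> < t / (1 - t) * ((1 - t) / t * r)"
    using u' t t0 by (intro mult_strict_left_mono) auto
  also have "\<dots> = r" using t t0 by simp
  finally have "dist w w' < r" .
  moreover have "w' \<in> T"
    unfolding w'_def using w u' uT ST \<open>subspace T\<close> by (auto intro!: subspace_add subspace_mul subspace_diff)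
  ultimately have "w' \<in> S" using r by auto
  then have "(1 - t) *\<^sub>R w' + t *\<^sub>R u' \<in> S"
    using u' t assms(1) by (simp add: convex_def)
  moreover have "(1 - t) *\<^sub>R w' + t *\<^sub>R u' = (1 - t) *\<^sub>R w + t *\<^sub>R u"
    using t by (simp add: w'_def scaleR_right_distrib) (simp add: algebra_simps)
  ultimately show ?thesis by simp
qed (use w in auto)

lemma line_derivative:
  fixes g :: "evec \<Rightarrow> 'b::real_normed_vector"
  assumes "p \<in> Rn d" "v \<in> Rn d" "(g has_derivative g') (at (p + t *\<^sub>R v) within Rn d)"
  shows "((\<lambda>t. g (p + t *\<^sub>R v)) has_vector_derivative g' v) (at t)"
proof -
  interpret bounded_linear g' using assms(3) by (rule has_derivative_bounded_linear)
  have "((\<lambda>t::real. p + t *\<^sub>R v) has_derivative (\<lambda>t. t *\<^sub>R v)) (at t)"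
    by (auto intro!: derivative_eq_intros)
  moreover have "range (\<lambda>t. p + t *\<^sub>R v) \<subseteq> Rn d"
    using assms subspace_Rn by (auto intro!: subspace_add subspace_mul)
  ultimately have "((\<lambda>t. g (p + t *\<^sub>R v)) has_derivative (\<lambda>s. g' (s *\<^sub>R v))) (at t)"
    using has_derivative_in_compose[of "\<lambda>t. p + t *\<^sub>R v" _ t UNIV g g']
      has_derivative_subset[OF assms(3)] by auto
  then show ?thesis by (simp add: has_vector_derivative_def scaleR)
qed

section \<open>The function \<open>psi\<close>, its inverse and the step size\<close>

lemma strict_mono_on_psi:
  assumes "L0 > 0" "L1 \<ge> 0"
  shows "strict_mono_on {0..} (psi (\<lambda>s. L0 + L1 * s))"
proof (rule strict_mono_onI)
  fix x y :: real assume xy: "x \<in> {0..}" "y \<in> {0..}" "x < y"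
  have "x\<^sup>2 < y\<^sup>2" using xy by (intro power_strict_mono) auto
  then have 1: "x\<^sup>2 * L0 < y\<^sup>2 * L0" using assms by simp
  have "x * (x * y) \<le> y * (x * y)" using xy by (intro mult_right_mono) auto
  then have "(x\<^sup>2 * y) * (4 * L1) \<le> (y\<^sup>2 * x) * (4 * L1)"
    using assms by (intro mult_right_mono) (auto simp: power2_eq_square mult_ac)
  with 1 have "x\<^sup>2 * (L0 + L1 * (4 * y)) < y\<^sup>2 * (L0 + L1 * (4 * x))"
    by (simp add: algebra_simps)
  moreover have "L0 + L1 * (4 * x) > 0" "L0 + L1 * (4 * y) > 0"
    using assms xy by (auto intro!: add_pos_nonneg)
  ultimately show "psi (\<lambda>s. L0 + L1 * s) x < psi (\<lambda>s. L0 + L1 * s) y"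
    unfolding psi_def by (simp add: divide_less_eq less_divide_eq field_simps)
qed

text \<open>The equation for \<open>M\<close> is quadratic: \<open>m\<close> is its explicit
  positive root, \<open>D\<close> being the root of a quarter of the discriminant, and injectivity
  of \<open>psi\<close> identifies \<open>m\<close> with \<open>M\<close>.\<close>

lemma psi_inv:
  assumes "L0 > 0" "L1 \<ge> 0" "t > 0"
  defines "M \<equiv> psi_inv (\<lambda>s. L0 + L1 * s) t"
  shows "M > 0" "psi (\<lambda>s. L0 + L1 * s) M = t" "M\<^sup>2 = 2 * t * (L0 + L1 * (4 * M))"
proof -
  define D where "D = sqrt ((4 * t * L1)\<^sup>2 + 2 * t * L0)"
  define m where "m = 4 * t * L1 + D"
  have D: "D > 0" "D\<^sup>2 = (4 * t * L1)\<^sup>2 + 2 * t * L0"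
    using assms by (auto simp: D_def add_nonneg_pos)
  have m: "m > 0" using D assms by (simp add: m_def add_nonneg_pos)
  have sq: "m\<^sup>2 = 2 * t * (L0 + L1 * (4 * m))"
    using D by (simp add: m_def power2_eq_square algebra_simps)
  have "L0 + L1 * (4 * m) > 0" using assms m by (auto intro!: add_pos_nonneg)
  then have psi: "psi (\<lambda>s. L0 + L1 * s) m = t"
    unfolding psi_def sq by (subst mult.assoc, subst mult_divide_mult_cancel_left) auto
  have "M = m"
    unfolding M_def psi_inv_def using m psi
    by (intro the_inv_into_f_eq strict_mono_on_imp_inj_on strict_mono_on_psi assms) auto
  then show "M > 0" "psi (\<lambda>s. L0 + L1 * s) M = t" "M\<^sup>2 = 2 * t * (L0 + L1 * (4 * M))"
    using m psi sq by auto
qed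

lemma step_size_lower_bound:
  assumes "L0 > 0" "L1 \<ge> 0" "\<Gamma> > 0" "Rb > 0"
  defines "ell \<equiv> \<lambda>s. L0 + L1 * s"
  shows "1 \<le> 7 * (sqrt (L0 / \<Gamma>) + L1 * Rb) *
    sqrt (1 / ell (4 * psi_inv ell (\<Gamma> * Rb\<^sup>2)) * \<Gamma>)"
proof -
  define t where "t = \<Gamma> * Rb\<^sup>2"
  define M where "M = psi_inv ell t"
  define l where "l = ell (4 * M)"
  define q where "q = sqrt (L0 / \<Gamma>)"
  have q: "q \<ge> 0" using assms by (simp add: q_def)
  have t: "t > 0" using assms by (simp add: t_def)
  have M: "M > 0" "M\<^sup>2 = 2 * t * l"
    using psi_inv[OF assms(1,2) t] by (simp_all add: M_def l_def ell_def)
  have l: "l > 0" using assms M by (auto simp: l_def ell_def intro!: add_pos_nonneg)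
  \<comment> \<open>AM-GM, weighted so that only half of \<open>l = L0 + 4 * L1 * M\<close>
    reappears on the right and can be absorbed.\<close>
  have "(4 * L1 * M)\<^sup>2 = 32 * L1\<^sup>2 * t * l"
    using M by (simp add: power_mult_distrib)
  also have "\<dots> \<le> (l / 2 + 16 * L1\<^sup>2 * t)\<^sup>2"
    using zero_le_power2[of "l / 2 - 16 * L1\<^sup>2 * t"] by (simp add: power2_eq_square algebra_simps)
  finally have "4 * L1 * M \<le> l / 2 + 16 * L1\<^sup>2 * t"
    using l t by (auto intro!: power2_le_imp_le[of "4 * L1 * M"])
  then have "l \<le> 2 * L0 + 32 * L1\<^sup>2 * t"
    by (simp add: l_def ell_def field_simps)
  then have "l / \<Gamma> \<le> (2 * L0 + 32 * L1\<^sup>2 * t) / \<Gamma>"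
    using assms by (intro divide_right_mono) auto
  also have "\<dots> = 2 * q\<^sup>2 + 32 * (L1 * Rb)\<^sup>2"
    using assms by (simp add: q_def t_def add_divide_distrib power_mult_distrib)
  \<comment> \<open>The constant 7 suffices because \<open>32 \<le> 49\<close>.\<close>
  also have "\<dots> \<le> (7 * (q + L1 * Rb))\<^sup>2"
    using q assms by (simp add: power2_eq_square algebra_simps)
  finally have "sqrt (l / \<Gamma>) \<le> 7 * (q + L1 * Rb)"
    using q assms by (intro real_le_lsqrt) auto
  then have "sqrt (l / \<Gamma>) * sqrt (1 / l * \<Gamma>) \<le>
      7 * (q + L1 * Rb) * sqrt (1 / l * \<Gamma>)"
    using l assms by (intro mult_right_mono) auto
  moreover have "sqrt (l / \<Gamma>) * sqrt (1 / l * \<Gamma>) = 1"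
    using l assms by (simp add: real_sqrt_mult[symmetric])
  ultimately show ?thesis by (simp add: l_def M_def t_def q_def)
qed

section \<open>Counting the steps until \<open>\<Gamma>\<close> is small\<close>

text \<open>\<open>\<Phi>\<close> is increasing and drops by 1/7 per step, so
  \<open>E < \<Gamma> k\<close> limits \<open>k\<close>. The case \<open>N = 0\<close> stands apart
  because the bound may be negative when \<open>\<Gamma> 0 \<le> E\<close>.\<close>

lemma steps_bound:
  fixes \<Gamma> :: "nat \<Rightarrow> real"
  assumes L0: "L0 > 0" and B: "B \<ge> 0" and pos: "\<And>k. \<Gamma> k > 0"
    and rec: "\<And>k. \<exists>\<alpha>\<ge>0. \<Gamma> (Suc k) = \<Gamma> k / (1 + \<alpha>) \<and> 1 \<le> 7 * (sqrt (L0 / \<Gamma> k) + B) * \<alpha>"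
    and E: "E > 0"
  obtains N where "\<Gamma> N \<le> E"
    "N = 0 \<or> real N \<le> 1 + 14 * sqrt (L0 / E) + 7 * (B + 1) * ln (\<Gamma> 0 / E)"
proof -
  define \<Phi> where "\<Phi> x = (B + 1) * ln x - 2 * sqrt (L0 / x)" for x
  have drop: "\<Phi> (\<Gamma> (Suc k)) \<le> \<Phi> (\<Gamma> k) - 1 / 7" for k
  proof -
    obtain \<alpha> where \<alpha>: "\<alpha> \<ge> 0" "\<Gamma> (Suc k) = \<Gamma> k / (1 + \<alpha>)" "1 \<le> 7 * (sqrt (L0 / \<Gamma> k) + B) * \<alpha>"
      using rec[of k] by blast
    define q where "q = sqrt (L0 / \<Gamma> k)"
    have q: "q \<ge> 0" using L0 pos[of k] by (simp add: q_def)
    define l where "l = ln (1 + \<alpha>)"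
    have "1 + l / 2 \<le> sqrt (1 + \<alpha>)"
      using ln_le_minus_one[of "sqrt (1 + \<alpha>)"] \<alpha> by (simp add: l_def ln_sqrt)
    then have 1: "q * l \<le> 2 * q * (sqrt (1 + \<alpha>) - 1)"
      using mult_left_mono[of "1 + l / 2" "sqrt (1 + \<alpha>)" "2 * q"] q by (simp add: algebra_simps)
    have "ln (1 / (1 + \<alpha>)) \<le> 1 / (1 + \<alpha>) - 1"
      using \<alpha> by (intro ln_le_minus_one) auto
    then have l: "\<alpha> / (1 + \<alpha>) \<le> l"
      using \<alpha> by (simp add: l_def ln_div field_simps)
    \<comment> \<open>Large \<open>\<alpha>\<close> changes the logarithm only slowly; the extra 1
      added to \<open>B\<close> pays for passing from \<open>\<alpha>\<close> to
      \<open>\<alpha> / (1 + \<alpha>)\<close>.\<close>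
    have "1 + \<alpha> \<le> 7 * (q + B + 1) * \<alpha>"
      using \<alpha> by (simp add: q_def algebra_simps)
    then have "1 / 7 \<le> (q + B + 1) * (\<alpha> / (1 + \<alpha>))"
      using \<alpha> by (simp add: field_simps)
    also have "\<dots> \<le> (q + B + 1) * l"
      using q B l by (intro mult_left_mono) auto
    also have "\<dots> \<le> 2 * q * (sqrt (1 + \<alpha>) - 1) + (B + 1) * l"
      using 1 by (simp add: algebra_simps)
    also have "\<dots> = \<Phi> (\<Gamma> k) - \<Phi> (\<Gamma> (Suc k))"
    proof -
      have "sqrt (L0 / \<Gamma> (Suc k)) = q * sqrt (1 + \<alpha>)"
        by (simp add: \<alpha>(2) q_def flip: real_sqrt_mult)
      moreover have "ln (\<Gamma> k) = ln (\<Gamma> (Suc k)) + l"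
        using \<alpha> pos[of k] by (simp add: l_def ln_div)
      ultimately show ?thesis by (simp add: \<Phi>_def q_def[symmetric] algebra_simps)
    qed
    finally show ?thesis by simp
  qed
  have \<Phi>_le: "\<Phi> (\<Gamma> k) \<le> \<Phi> (\<Gamma> 0) - k / 7" for k
    by (induction k) (use drop in \<open>auto simp: field_simps, smt (verit)\<close>)
  have mono: "\<Phi> E \<le> \<Phi> x" if "E \<le> x" for x
    unfolding \<Phi>_def using that E B L0
    by (intro diff_mono mult_left_mono real_sqrt_le_mono divide_left_mono) auto
  have k_le: "real k \<le> 14 * sqrt (L0 / E) + 7 * (B + 1) * ln (\<Gamma> 0 / E)" if "E < \<Gamma> k" for k
  proof -
    have "real k / 7 \<le> \<Phi> (\<Gamma> 0) - \<Phi> E" using mono[of "\<Gamma> k"] \<Phi>_le[of k] that by simp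
    also have "\<dots> \<le> (B + 1) * ln (\<Gamma> 0 / E) + 2 * sqrt (L0 / E)"
      using E pos[of 0] L0 by (simp add: \<Phi>_def ln_div algebra_simps)
    finally show ?thesis by (simp add: algebra_simps)
  qed
  obtain k :: nat where "14 * sqrt (L0 / E) + 7 * (B + 1) * ln (\<Gamma> 0 / E) < real k"
    using reals_Archimedean2 by blast
  then have ex: "\<Gamma> k \<le> E" using k_le[of k] by linarith
  \<comment> \<open>Minimality gives \<open>E < \<Gamma> m\<close> at the predecessor
    \<open>m\<close>, so \<open>k_le\<close> bounds \<open>m\<close>; the summand 1 is
    \<open>N - m\<close>.\<close>
  define N where "N = (LEAST k. \<Gamma> k \<le> E)"
  have "\<Gamma> N \<le> E" unfolding N_def using ex by (rule LeastI)
  moreover have "N = 0 \<or> real N \<le> 1 + 14 * sqrt (L0 / E) + 7 * (B + 1) * ln (\<Gamma> 0 / E)"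
  proof (cases N)
    case (Suc m)
    then have "\<not> \<Gamma> m \<le> E" using not_less_Least[of m "\<lambda>k. \<Gamma> k \<le> E"] by (simp add: N_def)
    then show ?thesis using k_le[of m] Suc by simp
  qed simp
  ultimately show thesis by (rule that)
qed

section \<open>Absorbing logarithms into the claimed bound\<close>

lemma ln_le_2_sqrt:
  assumes "x > 0"
  shows "ln x \<le> 2 * sqrt (x :: real)"
  using ln_le_minus_one[of "sqrt x"] assms by (simp add: ln_sqrt)

text \<open>
  The bound has no additive constant: \<open>g > 2E\<close> keeps \<open>D\<close> away from \<open>0\<close>, since either \<open>L0 \<ge> E\<close> or
  \<open>g / L0 > 2\<close>.
\<close>

lemma log_terms_bound:
  assumes L0: "L0 > 0" and B: "B \<ge> 0" and E: "E > 0" and g: "g > 2 * E"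
  defines "D \<equiv> sqrt (L0 / E) + max (B * ln (min (B\<^sup>2 * g / L0) (g / E))) 0 + max (ln (g / L0)) 0"
  shows "1 + 14 * sqrt (L0 / E) + 7 * (B + 1) * ln (g / E) \<le> 44 * D"
proof -
  define q where "q = sqrt (L0 / E)"
  have q: "q > 0" using L0 E by (simp add: q_def)
  have gpos: "g > 0" using g E by simp
  have 1: "ln (g / E) \<le> max (ln (g / L0)) 0 + 2 * q"
  proof -
    have "ln (g / E) = ln (g / L0) + ln (L0 / E)" using gpos L0 E by (simp add: ln_div)
    then show ?thesis using ln_le_2_sqrt[of "L0 / E"] L0 E by (simp add: q_def)
  qed
  \<comment> \<open>If the minimum is not \<open>g / E\<close>, the two logarithms differ by at most
    \<open>2 * q / B\<close>, and the factor \<open>B\<close> cancels.\<close>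
  have 2: "B * ln (g / E) \<le> max (B * ln (min (B\<^sup>2 * g / L0) (g / E))) 0 + 2 * q"
  proof (cases "B = 0 \<or> g / E \<le> B\<^sup>2 * g / L0")
    case True
    then show ?thesis using q by (auto simp: min_def)
  next
    case False
    then have Bpos: "B > 0" and m: "min (B\<^sup>2 * g / L0) (g / E) = B\<^sup>2 * g / L0"
      using B by auto
    have "ln (g / E) = ln (B\<^sup>2 * g / L0) + ln (L0 / (B\<^sup>2 * E))"
      using gpos L0 E Bpos by (simp add: ln_div ln_mult)
    also have "ln (L0 / (B\<^sup>2 * E)) \<le> 2 * sqrt (L0 / (B\<^sup>2 * E))"
      using L0 E Bpos by (intro ln_le_2_sqrt) simp
    also have "sqrt (L0 / (B\<^sup>2 * E)) = q / B"
      using Bpos by (simp add: q_def real_sqrt_divide real_sqrt_mult)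
    finally have "B * ln (g / E) \<le> B * (ln (B\<^sup>2 * g / L0) + 2 * (q / B))"
      using Bpos by (intro mult_left_mono) auto
    then show ?thesis unfolding m using Bpos by (simp add: algebra_simps)
  qed
  have 3: "1 \<le> 2 * D"
  proof (cases "L0 \<ge> E")
    case True
    then have "q \<ge> 1" using E by (simp add: q_def)
    moreover have "q \<le> D"
      unfolding D_def q_def[symmetric] by (intro add_increasing2) auto
    ultimately show ?thesis by simp
  next
    case False
    then have "2 \<le> g / L0" using g L0 by (simp add: field_simps)
    then have "ln 2 \<le> ln (g / L0)" by simp
    moreover have "ln (2::real) \<ge> 1 / 2" using ln_le_minus_one[of "1 / 2 :: real"] by (simp add: ln_div)
    moreover have "ln (g / L0) \<le> D"
      unfolding D_def q_def[symmetric] using q by (intro add_increasing) auto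
    ultimately show ?thesis by simp
  qed
  \<comment> \<open>Origin of 44: fact \<open>3\<close> costs \<open>2 * D\<close>; 14 copies of
    \<open>q\<close> are explicit, and facts \<open>1\<close> and \<open>2\<close>, each multiplied
    by 7, add 14 more apiece.\<close>
  show ?thesis using 1 2 3 q unfolding D_def q_def[symmetric] by (simp add: algebra_simps)
qed

section \<open>Smoothness and convexity on the domain\<close>

locale L0L1_smooth_convex =
  fixes d :: nat and f :: "evec \<Rightarrow> ereal" and L0 L1 :: real and xs :: evec
  assumes L0: "L0 > 0" and L1: "L1 \<ge> 0"
    and proper: "proper_domain d f"
    and cvx: "ext_convex d f"
    and smooth: "ell_smooth d f (\<lambda>s. L0 + L1 * s)"
    and xs_Rn: "xs \<in> Rn d"
    and xs_min: "\<And>z. z \<in> Rn d \<Longrightarrow> f xs \<le> f z"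
begin

abbreviation X where "X \<equiv> edomain d f"
abbreviation F where "F z \<equiv> real_of_ereal (f z)"
abbreviation G where "G \<equiv> grad d f"
abbreviation ell where "ell \<equiv> \<lambda>s. L0 + L1 * s"

lemma X_Rn: "x \<in> X \<Longrightarrow> x \<in> Rn d"
  by (simp add: edomain_def)

lemma f_eq: "x \<in> X \<Longrightarrow> f x = ereal (F x)"
  using proper by (auto simp: edomain_def proper_domain_def intro!: ereal_real'[symmetric])

lemma xs_X: "xs \<in> X"
proof -
  obtain x where "x \<in> X" using proper by (auto simp: proper_domain_def)
  then show ?thesis using xs_min[of x] xs_Rn by (auto simp: edomain_def)
qed

lemma F_xs_le: "x \<in> X \<Longrightarrow> F xs \<le> F x"
  using xs_min[of x] f_eq[of x] f_eq[OF xs_X] X_Rn by (metis ereal_less_eq(3))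

lemma convex_X: "convex X" and openin_X: "openin (top_of_set (Rn d)) X"
  using proper by (auto simp: proper_domain_def)

lemma closure_X_Rn: "closure X \<subseteq> Rn d"
  by (rule closure_minimal) (auto simp: X_Rn closed_Rn)

lemma ell_pos: "s \<ge> 0 \<Longrightarrow> ell s > 0"
  using L0 L1 by (simp add: add_pos_nonneg)

lemma is_gradient_G: "x \<in> X \<Longrightarrow> is_gradient d f x (G x)"
  using smooth unfolding ell_smooth_def grad_def by (metis someI_ex)

lemma G_Rn: "x \<in> X \<Longrightarrow> G x \<in> Rn d"
  using is_gradient_G by (simp add: is_gradient_def)

lemma G_has_derivative: "x \<in> X \<Longrightarrow> (G has_derivative hessian d f x) (at x within Rn d)"
  using smooth unfolding ell_smooth_def hessian_def by (metis frechet_derivative_works)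

text \<open>Homogeneity reduces this to unit vectors, where the supremum in
  \<open>spectral_norm\<close> is an upper bound because the derivative is a bounded map.\<close>

lemma norm_hessian_le:
  assumes "x \<in> X" "v \<in> Rn d"
  shows "norm (hessian d f x v) \<le> ell (norm (G x)) * norm v"
proof (cases "v = 0")
  case False
  interpret H: bounded_linear "hessian d f x"
    using G_has_derivative[OF assms(1)] by (rule has_derivative_bounded_linear)
  define w where "w = v /\<^sub>R norm v"
  have w: "w \<in> Rn d" "norm w = 1"
    using False assms(2) by (simp_all add: w_def subspace_mul[OF subspace_Rn])
  obtain K where K: "\<And>x'. norm (hessian d f x x') \<le> norm x' * K"
    using H.bounded by blast
  have "norm (hessian d f x w) \<le> spectral_norm d (hessian d f x)"
    unfolding spectral_norm_def
    using w K by (intro cSUP_upper bdd_aboveI2[where M = K]) (auto, metis mult_1)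
  also have "\<dots> \<le> ell (norm (G x))"
    using smooth assms(1) by (simp add: ell_smooth_def)
  finally have "norm v * norm (hessian d f x w) \<le> norm v * ell (norm (G x))"
    by (intro mult_left_mono) auto
  moreover have "hessian d f x v = norm v *\<^sub>R hessian d f x w"
    using False by (simp add: w_def H.scaleR)
  ultimately show ?thesis by (simp add: mult.commute)
next
  case True
  then show ?thesis
    using has_derivative_bounded_linear[OF G_has_derivative[OF assms(1)]]
    by (simp add: linear_simps)
qed

lemma F_line:
  assumes "p \<in> Rn d" "v \<in> Rn d" "p + t *\<^sub>R v \<in> X"
  shows "((\<lambda>t. F (p + t *\<^sub>R v)) has_real_derivative inner (G (p + t *\<^sub>R v)) v) (at t)"
  using line_derivative[OF assms(1,2), of F] is_gradient_G[OF assms(3)]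
  by (simp add: is_gradient_def has_real_derivative_iff_has_vector_derivative)

lemma G_line:
  assumes "p \<in> Rn d" "v \<in> Rn d" "p + t *\<^sub>R v \<in> X"
  shows "((\<lambda>t. G (p + t *\<^sub>R v)) has_vector_derivative hessian d f (p + t *\<^sub>R v) v) (at t)"
  by (rule line_derivative[OF assms(1,2) G_has_derivative[OF assms(3)]])

lemma continuous_on_G: "continuous_on X G"
proof -
  have "continuous (at x within X) G" if "x \<in> X" for x
    using has_derivative_continuous[OF G_has_derivative[OF that]]
    by (rule continuous_within_subset) (auto simp: X_Rn)
  then show ?thesis by (simp add: continuous_on_eq_continuous_within)
qed

text \<open>Convexity bounds the difference quotients along the segment by \<open>F z - F x\<close>;
  let the parameter tend to 0 from the right.\<close>

lemma F_above_tangent: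
  assumes x: "x \<in> X" and z: "z \<in> X"
  shows "F x + inner (G x) (z - x) \<le> F z"
proof -
  define h where "h t = F (x + t *\<^sub>R (z - x))" for t
  have v: "z - x \<in> Rn d"
    using x z X_Rn subspace_Rn by (simp add: subspace_diff)
  have "(h has_real_derivative inner (G x) (z - x)) (at 0)"
    unfolding h_def using F_line[of x "z - x" 0] x v by (simp add: X_Rn)
  then have "((\<lambda>t. (h t - h 0) / t) \<longlongrightarrow> inner (G x) (z - x)) (at_right 0)"
    unfolding has_field_derivative_iff by (simp add: filterlim_at_split)
  moreover have "eventually (\<lambda>t. (h t - h 0) / t \<le> F z - F x) (at_right 0)"
  proof -
    have "(h t - h 0) / t \<le> F z - F x" if t: "0 < t" "t < 1" for t
    proof -
      have eq: "x + t *\<^sub>R (z - x) = (1 - t) *\<^sub>R x + t *\<^sub>R z"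
        by (simp add: algebra_simps)
      have "(1 - t) *\<^sub>R x + t *\<^sub>R z \<in> X"
        using convex_X x z t by (simp add: convex_def)
      then have "ereal (h t) \<le> ereal (1 - t) * ereal (F x) + ereal t * ereal (F z)"
        using cvx x z t unfolding ext_convex_def h_def eq
        by (metis X_Rn f_eq greaterThanLessThan_iff)
      then have "h t - h 0 \<le> (F z - F x) * t"
        by (simp add: h_def algebra_simps)
      then show ?thesis using t by (simp add: divide_le_eq)
    qed
    then show ?thesis
      unfolding eventually_at_right_field by (intro exI[of _ 1]) auto
  qed
  ultimately have "inner (G x) (z - x) \<le> F z - F x"
    by (intro tendsto_upperbound) auto
  then show ?thesis by simp
qed

text \<open>
  As long as the segment stays in the region \<open>\<parallel>\<nabla>f\<parallel> < 4M\<close>, the gradient moves by at most \<open>\<parallel>h\<parallel> < 3M\<close>, so the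
  gradient condition cannot fail first; and \<open>f\<close> stays bounded, so the segment cannot reach the
  boundary of the domain, where \<open>f\<close> tends to \<open>\<infinity>\<close>.
\<close>

lemma gradient_step:
  assumes y: "y \<in> X" and M: "M > 0" "norm (G y) \<le> M"
    and h: "h \<in> Rn d" "norm h < 3 * M"
    and \<gamma>: "0 \<le> \<gamma>" "\<gamma> * ell (4 * M) \<le> 1"
  shows "y - \<gamma> *\<^sub>R h \<in> X"
    and "F (y - \<gamma> *\<^sub>R h) \<le> F y - \<gamma> * inner (G y) h + \<gamma> / 2 * (norm h)\<^sup>2"
proof -
  define v where "v = - (\<gamma> *\<^sub>R h)"
  define z where "z t = y + t *\<^sub>R v" for t :: real
  have v: "v \<in> Rn d"
    using h subspace_Rn by (simp add: v_def subspace_mul subspace_neg)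
  have yR: "y \<in> Rn d" using y by (rule X_Rn)
  have zR: "z t \<in> Rn d" for t
    using v yR subspace_Rn by (simp add: z_def subspace_add subspace_mul)
  define U where "U = {x \<in> X. norm (G x) < 4 * M}"
  \<comment> \<open>On \<open>U\<close> the Hessian is at most \<open>ell (4 * M)\<close>, and
    \<open>v\<close> carries a factor \<open>\<gamma>\<close>; since
    \<open>\<gamma> * ell (4 * M) \<le> 1\<close>, the gradient along \<open>z\<close> has Lipschitz
    constant \<open>norm h\<close>.\<close>
  have G_close: "norm (G (z t) - G y) \<le> t * norm h"
    if t: "0 \<le> t" and good: "\<And>s. 0 \<le> s \<Longrightarrow> s \<le> t \<Longrightarrow> z s \<in> U" for t
  proof -
    have "norm (G (z t) - G (z 0)) \<le> norm h * norm (t - 0)"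
    proof (rule differentiable_bound[of "{0..t}"])
      fix s assume s: "s \<in> {0..t}"
      then have sU: "z s \<in> X" "norm (G (z s)) < 4 * M"
        using good[of s] by (auto simp: U_def)
      show "((\<lambda>t. G (z t)) has_derivative (\<lambda>r. r *\<^sub>R hessian d f (z s) v)) (at s within {0..t})"
        using G_line[OF yR v, of s] sU
        by (simp add: z_def has_vector_derivative_def has_derivative_at_withinI)
      have "norm (hessian d f (z s) v) \<le> ell (norm (G (z s))) * norm v"
        by (rule norm_hessian_le) (use sU v in auto)
      also have "\<dots> \<le> ell (4 * M) * norm v"
        using sU L1 by (intro mult_right_mono add_mono mult_left_mono) auto
      also have "\<dots> = \<gamma> * ell (4 * M) * norm h"
        using \<gamma> by (simp add: v_def)
      also have "\<dots> \<le> norm h"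
        using mult_right_mono[OF \<gamma>(2) norm_ge_zero[of h]] by simp
      finally have "norm (hessian d f (z s) v) \<le> norm h" .
      then have "norm (r *\<^sub>R hessian d f (z s) v) \<le> norm h * norm r" for r :: real
        using mult_left_mono[of _ "norm h" "\<bar>r\<bar>"] by (subst mult.commute) simp
      then show "onorm (\<lambda>r::real. r *\<^sub>R hessian d f (z s) v) \<le> norm h"
        by (intro onorm_bound) auto
    qed (use t in auto)
    then show ?thesis using t by (simp add: z_def mult.commute)
  qed
  have zU: "z t \<in> U" if "t \<in> {0..1}" for t
  proof (rule ccontr)
    assume "z t \<notin> U"
    \<comment> \<open>The times outside \<open>U\<close>. As \<open>U\<close> is relatively open,
      \<open>B\<close> is compact, so there is a first bad time \<open>t0\<close> to refute.\<close>
    define B where "B = {0..1} \<inter> - (z -` U)"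
    have "openin (top_of_set X) (X \<inter> G -` ball 0 (4 * M))"
      by (rule continuous_openin_preimage_gen[OF continuous_on_G open_ball])
    also have "X \<inter> G -` ball 0 (4 * M) = U" by (auto simp: U_def)
    finally have "openin (top_of_set (Rn d)) U"
      using openin_X openin_trans by blast
    then obtain W where W: "open W" "U = Rn d \<inter> W" by (auto simp: openin_open)
    have "z -` U = z -` W" using W zR by auto
    moreover have "open (z -` W)"
      unfolding z_def by (intro open_vimage W continuous_intros)
    ultimately have "compact B"
      unfolding B_def by (metis compact_Icc compact_Int_closed closed_Compl)
    moreover have "B \<noteq> {}" using \<open>z t \<notin> U\<close> that by (auto simp: B_def)
    ultimately have "\<exists>t0\<in>B. \<forall>s\<in>B. t0 \<le> s"
      by (rule compact_attains_inf)
    then obtain t0 where t0: "t0 \<in> B" "\<And>s. s \<in> B \<Longrightarrow> t0 \<le> s" by auto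
    have "z 0 \<in> U" using y M by (simp add: z_def U_def)
    then have t0pos: "t0 > 0" "t0 \<le> 1"
      using t0(1) by (auto simp: B_def less_le)
    have good: "z s \<in> U" if "0 \<le> s" "s < t0" for s
      using that t0pos t0(2)[of s] by (auto simp: B_def)
    define r where "r = M + norm h"
    have r: "0 \<le> r" "r < 4 * M" using h M by (simp_all add: r_def)
    have Gr: "norm (G (z s)) \<le> r" if s: "0 \<le> s" "s < t0" for s
    proof -
      have "norm (G (z s) - G y) \<le> s * norm h"
        using s good by (intro G_close) auto
      also have "\<dots> \<le> norm h"
        using s t0pos by (intro mult_left_le_one_le) auto
      finally show ?thesis
        using M norm_triangle_ineq2[of "G (z s)" "G y"] by (simp add: r_def)
    qed
    \<comment> \<open>The tangent at \<open>z s\<close>, evaluated at \<open>y\<close>, bounds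
      \<open>f (z s)\<close> uniformly before \<open>t0\<close>; continuity on the closure extends
      the bound to \<open>t0\<close>.\<close>
    define K where "K = F y + r * norm v"
    have fK: "f (z s) \<le> ereal K" if s: "0 \<le> s" "s < t0" for s
    proof -
      have zs: "z s \<in> X" using good[OF s] by (simp add: U_def)
      have "F (z s) \<le> F y + s * inner (G (z s)) v"
        using F_above_tangent[OF zs y] by (simp add: z_def)
      also have "s * inner (G (z s)) v \<le> s * (norm (G (z s)) * norm v)"
        using s by (intro mult_left_mono norm_cauchy_schwarz) auto
      also have "\<dots> \<le> 1 * (r * norm v)"
        using s t0pos Gr[OF s] r by (intro mult_mono) auto
      finally show ?thesis by (subst f_eq[OF zs]) (simp add: K_def)
    qed
    have cl: "closure {0..<t0} = {0..t0}" using t0pos by simp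
    have zc: "continuous_on S z" for S unfolding z_def by (intro continuous_intros)
    have "closed (closure X \<inter> f -` {..ereal K})"
      using smooth by (intro continuous_closed_preimage) (auto simp: ell_smooth_def)
    then have "z ` closure {0..<t0} \<subseteq> closure X \<inter> f -` {..ereal K}"
      using fK good closure_subset[of X]
      by (intro image_closure_subset zc) (auto simp: U_def)
    then have "z t0 \<in> closure X \<inter> f -` {..ereal K}"
      by (rule subsetD) (use t0pos in \<open>simp add: cl\<close>)
    then have "f (z t0) \<le> ereal K" by simp
    then have zt0: "z t0 \<in> X"
      using zR by (auto simp: edomain_def)
    have zX: "z s \<in> X" if "0 \<le> s" "s \<le> t0" for s
      using that zt0 good[of s] by (cases "s = t0") (auto simp: U_def)
    have "continuous_on (closure {0..<t0}) (\<lambda>s. G (z s))"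
      unfolding cl using zX by (intro continuous_on_compose2[OF continuous_on_G zc]) auto
    then have "(\<lambda>s. G (z s)) ` closure {0..<t0} \<subseteq> cball 0 r"
      using Gr by (intro image_closure_subset) auto
    then have "G (z t0) \<in> cball 0 r"
      by (rule subsetD) (use t0pos in \<open>simp add: cl\<close>)
    then have "norm (G (z t0)) \<le> r" by simp
    then have "z t0 \<in> U" using zt0 r by (simp add: U_def)
    then show False using t0(1) by (simp add: B_def)
  qed
  have z1: "z 1 = y - \<gamma> *\<^sub>R h" by (simp add: z_def v_def)
  show "y - \<gamma> *\<^sub>R h \<in> X" using zU[of 1] z1 by (simp add: U_def)
  \<comment> \<open>\<open>F\<close> along the segment minus its quadratic upper model;
    \<open>G_close\<close> makes the derivative nonpositive.\<close>
  define \<phi> where "\<phi> t = F (z t) - t * inner (G y) v - t\<^sup>2 / 2 * (\<gamma> * (norm h)\<^sup>2)" for t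
  have "\<exists>s. 0 < s \<and> s < 1 \<and> \<phi> 1 - \<phi> 0 =
      (1 - 0) * (inner (G (z s)) v - inner (G y) v - s * (\<gamma> * (norm h)\<^sup>2))"
  proof (rule MVT2)
    fix s :: real assume "0 \<le> s" "s \<le> 1"
    then have "z s \<in> X" using zU[of s] by (auto simp: U_def)
    then have "((\<lambda>t. F (z t)) has_real_derivative inner (G (z s)) v) (at s)"
      using F_line[OF yR v] by (simp add: z_def)
    then show "(\<phi> has_real_derivative
        inner (G (z s)) v - inner (G y) v - s * (\<gamma> * (norm h)\<^sup>2)) (at s)"
      unfolding \<phi>_def by (auto intro!: derivative_eq_intros)
  qed simp
  then obtain s where s: "0 < s" "s < 1"
    and eq: "\<phi> 1 - \<phi> 0 = inner (G (z s) - G y) v - s * (\<gamma> * (norm h)\<^sup>2)"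
    by (auto simp: inner_diff_left)
  have "inner (G (z s) - G y) v \<le> norm (G (z s) - G y) * norm v"
    by (rule norm_cauchy_schwarz)
  also have "\<dots> \<le> (s * norm h) * norm v"
    using s zU by (intro mult_right_mono G_close) auto
  also have "\<dots> = s * (\<gamma> * (norm h)\<^sup>2)"
    using \<gamma> by (simp add: v_def power2_eq_square)
  finally have "\<phi> 1 \<le> \<phi> 0" using eq by simp
  then show "F (y - \<gamma> *\<^sub>R h) \<le> F y - \<gamma> * inner (G y) h + \<gamma> / 2 * (norm h)\<^sup>2"
    unfolding z1[symmetric] by (simp add: \<phi>_def) (simp add: z_def v_def)
qed

section \<open>Gradient bound and decrease of the Lyapunov function\<close>

text \<open>A gradient step of length \<open>1 / l\<close> lowers \<open>F\<close> by at least the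
  left-hand side, and \<open>F\<close> cannot fall below \<open>F xs\<close>.\<close>

lemma psi_norm_gradient_le:
  assumes y: "y \<in> X"
  shows "psi ell (norm (G y)) \<le> F y - F xs"
proof (cases "G y = 0")
  case True
  then show ?thesis using F_xs_le[OF y] by (simp add: psi_def)
next
  case False
  define l where "l = ell (4 * norm (G y))"
  have l: "l > 0" unfolding l_def by (rule ell_pos) simp
  note step = gradient_step[OF y, of "norm (G y)" "G y" "1 / l"]
  have z: "y - (1 / l) *\<^sub>R G y \<in> X"
    using l False by (intro step(1)) (auto simp: l_def[symmetric] G_Rn y)
  have "F (y - (1 / l) *\<^sub>R G y) \<le> F y - 1 / l * inner (G y) (G y) + 1 / l / 2 * (norm (G y))\<^sup>2"
    using l False by (intro step(2)) (auto simp: l_def[symmetric] G_Rn y)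
  also have "\<dots> = F y - (norm (G y))\<^sup>2 / (2 * l)"
    using l by (simp add: power2_norm_eq_inner field_simps)
  finally show ?thesis
    using F_xs_le[OF z] by (simp add: psi_def l_def)
qed

lemma norm_gradient_le:
  assumes "y \<in> X" "M \<ge> 0" "F y - F xs \<le> psi ell M"
  shows "norm (G y) \<le> M"
proof (rule ccontr)
  assume "\<not> norm (G y) \<le> M"
  then have "psi ell M < psi ell (norm (G y))"
    using assms(2) strict_mono_onD[OF strict_mono_on_psi[OF L0 L1]] by simp
  then show False using psi_norm_gradient_le[OF assms(1)] assms(3) by simp
qed

text \<open>The auxiliary point \<open>z\<close> is the key: the tangent at \<open>y'\<close> bounds
  \<open>F z\<close> from below and \<open>gradient_step\<close> bounds it from above, which acts as
  a cocoercivity inequality between \<open>y\<close> and \<open>y'\<close>. The factor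
  \<open>3 / 2\<close> keeps \<open>norm h\<close> below \<open>3 * M\<close>.\<close>

lemma estimate_sequence_step:
  assumes y: "y \<in> X" and M: "M > 0" "norm (G y) \<le> M"
    and \<Gamma>: "\<Gamma> > 0" and \<gamma>: "0 \<le> \<gamma>" "\<gamma> * ell (4 * M) \<le> 1"
    and \<alpha>: "\<alpha> \<ge> 0" "\<alpha>\<^sup>2 = \<gamma> * \<Gamma>"
    and y': "y' \<in> X" "(1 + \<alpha>) *\<^sub>R y' = y + \<alpha> *\<^sub>R u - \<gamma> *\<^sub>R G y"
    and Gy': "norm (G y') \<le> 3 / 2 * M"
  shows "(1 + \<alpha>) * (F y' - F xs) + \<Gamma> / 2 * (norm (u - (\<alpha> / \<Gamma>) *\<^sub>R G y' - xs))\<^sup>2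
    \<le> F y - F xs + \<Gamma> / 2 * (norm (u - xs))\<^sup>2"
proof -
  define h where "h = G y - G y'"
  define z where "z = y - \<gamma> *\<^sub>R h"
  have h: "h \<in> Rn d" unfolding h_def by (intro subspace_diff[OF subspace_Rn] G_Rn y y'(1))
  have "norm h < 3 * M"
    using norm_triangle_ineq4[of "G y" "G y'"] M Gy' by (simp add: h_def)
  note step = gradient_step[OF y M h this \<gamma>, folded z_def]
  have 1: "F y' + inner (G y') (z - y') \<le> F y - \<gamma> * inner (G y) h + \<gamma> / 2 * (norm h)\<^sup>2"
    using F_above_tangent[OF y'(1) step(1)] step(2) by simp
  have 2: "\<alpha> * F y' + \<alpha> * inner (G y') (xs - y') \<le> \<alpha> * F xs"
    using mult_left_mono[OF F_above_tangent[OF y'(1) xs_X] \<alpha>(1)] by (simp add: algebra_simps)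
  \<comment> \<open>The weights 1 and \<open>\<alpha>\<close> match the equation for
    \<open>y'\<close>, so \<open>y'\<close> and \<open>y\<close> cancel.\<close>
  have "inner (G y') (z - y') + \<alpha> * inner (G y') (xs - y')
      = inner (G y') (z + \<alpha> *\<^sub>R xs - (1 + \<alpha>) *\<^sub>R y')"
    by (simp add: inner_diff_right inner_add_right algebra_simps)
  also have "\<dots> = inner (G y') (\<alpha> *\<^sub>R (xs - u) + \<gamma> *\<^sub>R G y')"
    unfolding y'(2) z_def h_def by (simp add: algebra_simps)
  also have "\<dots> = - (\<alpha> * inner (G y') (u - xs)) + \<gamma> * inner (G y') (G y')"
    by (simp add: inner_diff_right inner_add_right algebra_simps)
  finally have 3: "(1 + \<alpha>) * (F y' - F xs) \<le> F y - F xs + \<alpha> * inner (G y') (u - xs)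
      - \<gamma> * inner (G y') (G y') - \<gamma> * inner (G y) h + \<gamma> / 2 * (norm h)\<^sup>2"
    using 1 2 by (simp add: algebra_simps)
  have "(norm (u - (\<alpha> / \<Gamma>) *\<^sub>R G y' - xs))\<^sup>2 = (norm (u - xs))\<^sup>2
      - 2 * (\<alpha> / \<Gamma>) * inner (G y') (u - xs) + (\<alpha> / \<Gamma>)\<^sup>2 * inner (G y') (G y')"
    unfolding power2_norm_eq_inner
    by (simp add: inner_diff_left inner_diff_right inner_add_left inner_add_right inner_commute
        algebra_simps power2_eq_square)
  then have "\<Gamma> / 2 * (norm (u - (\<alpha> / \<Gamma>) *\<^sub>R G y' - xs))\<^sup>2 =
      \<Gamma> / 2 * (norm (u - xs))\<^sup>2 - \<alpha> * inner (G y') (u - xs) + \<alpha>\<^sup>2 / (2 * \<Gamma>) * inner (G y') (G y')"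
    using \<Gamma> by (simp add: field_simps power2_eq_square)
  \<comment> \<open>With this coefficient all terms in \<open>G y'\<close> cancel in fact
    \<open>5\<close>.\<close>
  also have "\<alpha>\<^sup>2 / (2 * \<Gamma>) = \<gamma> / 2" using \<alpha> \<Gamma> by simp
  finally have 4: "\<Gamma> / 2 * (norm (u - (\<alpha> / \<Gamma>) *\<^sub>R G y' - xs))\<^sup>2 =
      \<Gamma> / 2 * (norm (u - xs))\<^sup>2 - \<alpha> * inner (G y') (u - xs) + \<gamma> / 2 * inner (G y') (G y')" .
  have 5: "- \<gamma> * inner (G y') (G y') - \<gamma> * inner (G y) h + \<gamma> / 2 * (norm h)\<^sup>2
      + \<gamma> / 2 * inner (G y') (G y') = - (\<gamma> / 2 * inner (G y) (G y))"
    unfolding power2_norm_eq_inner h_def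
    by (simp add: inner_diff_left inner_diff_right inner_commute field_simps)
  have "\<gamma> / 2 * inner (G y) (G y) \<ge> 0" using \<gamma> by simp
  with 3 4 5 show ?thesis by linarith
qed

lemma accelerated_step:
  assumes y: "y \<in> X" and u: "u \<in> closure X" and M: "M > 0" and \<Gamma>: "\<Gamma> > 0"
    and bound: "F y - F xs + \<Gamma> / 2 * (norm (u - xs))\<^sup>2 \<le> psi ell M"
  defines "\<gamma> \<equiv> 1 / ell (4 * M)"
  defines "\<alpha> \<equiv> sqrt (\<gamma> * \<Gamma>)"
  defines "y' \<equiv> (1 / (1 + \<alpha>)) *\<^sub>R y + (\<alpha> / (1 + \<alpha>)) *\<^sub>R u - (\<gamma> / (1 + \<alpha>)) *\<^sub>R G y"
  defines "u' \<equiv> Proj (closure X) (u - (\<alpha> / \<Gamma>) *\<^sub>R G y')"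
  shows "y' \<in> X" "u' \<in> closure X"
    "(1 + \<alpha>) * (F y' - F xs) + \<Gamma> / 2 * (norm (u' - xs))\<^sup>2
      \<le> F y - F xs + \<Gamma> / 2 * (norm (u - xs))\<^sup>2"
proof -
  have l: "ell (4 * M) > 0" by (rule ell_pos) (use M in simp)
  have \<gamma>: "\<gamma> > 0" "\<gamma> * ell (4 * M) = 1" using l by (simp_all add: \<gamma>_def)
  have nn: "\<Gamma> / 2 * (norm w)\<^sup>2 \<ge> 0" for w :: evec using \<Gamma> by simp
  have Gy: "norm (G y) \<le> M"
    using bound nn[of "u - xs"] M by (intro norm_gradient_le y) auto
  \<comment> \<open>\<open>Y s\<close> is the new point for step size \<open>s * \<gamma>\<close>;
    it runs from \<open>y\<close> at 0 to \<open>y'\<close> at 1.\<close>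
  define a where "a s = sqrt (s * \<gamma> * \<Gamma>)" for s
  define Y where "Y s = (1 / (1 + a s)) *\<^sub>R y + (a s / (1 + a s)) *\<^sub>R u
    - (s * \<gamma> / (1 + a s)) *\<^sub>R G y" for s
  have a0: "a s \<ge> 0" if "s \<ge> 0" for s using that \<gamma> \<Gamma> by (simp add: a_def)
  have sl: "s * \<gamma> * ell (4 * M) \<le> 1" if "s \<le> 1" for s
    using that \<gamma> by (simp add: mult.assoc)
  \<comment> \<open>A convex combination of a gradient step from \<open>y\<close>, inside the
    domain, and \<open>u\<close>, whose weight is below 1.\<close>
  have YX: "Y s \<in> X" if s: "0 \<le> s" "s \<le> 1" for s
  proof -
    have "y - (s * \<gamma>) *\<^sub>R G y \<in> X"
      using s \<gamma> M Gy by (intro gradient_step(1)[OF y M Gy] sl G_Rn y) auto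
    then have "(1 - a s / (1 + a s)) *\<^sub>R (y - (s * \<gamma>) *\<^sub>R G y) + (a s / (1 + a s)) *\<^sub>R u \<in> X"
      using a0[OF s(1)] u
      by (intro openin_convex_shrink[OF convex_X openin_X subspace_Rn closed_Rn]) auto
    moreover have "1 - a s / (1 + a s) = 1 / (1 + a s)"
      using a0[OF s(1)] by (simp add: field_simps)
    ultimately show ?thesis by (simp add: Y_def algebra_simps)
  qed
  have step: "(1 + a s) * (F (Y s) - F xs) + \<Gamma> / 2 * (norm (u - (a s / \<Gamma>) *\<^sub>R G (Y s) - xs))\<^sup>2
      \<le> F y - F xs + \<Gamma> / 2 * (norm (u - xs))\<^sup>2"
    if s: "0 \<le> s" "s \<le> 1" and "norm (G (Y s)) \<le> 3 / 2 * M" for s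
  proof (rule estimate_sequence_step[OF y M Gy \<Gamma> _ sl[OF s(2)] a0[OF s(1)] _ YX[OF s] _ that(3)])
    show "0 \<le> s * \<gamma>" using s \<gamma> by simp
    show "(a s)\<^sup>2 = s * \<gamma> * \<Gamma>" using s \<gamma> \<Gamma> by (simp add: a_def)
    show "(1 + a s) *\<^sub>R Y s = y + a s *\<^sub>R u - (s * \<gamma>) *\<^sub>R G y"
      using a0[OF s(1)] by (simp add: Y_def scaleR_right_distrib scaleR_right_diff_distrib)
  qed
  have imp: "norm (G (Y s)) \<le> M" if s: "0 \<le> s" "s \<le> 1" and "norm (G (Y s)) \<le> 3 / 2 * M" for s
  proof (rule norm_gradient_le[OF YX[OF s]])
    have "F (Y s) - F xs \<le> (1 + a s) * (F (Y s) - F xs)"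
      using a0[OF s(1)] F_xs_le[OF YX[OF s]] by (simp add: algebra_simps mult_left_mono)
    then show "F (Y s) - F xs \<le> psi ell M"
      using step[OF that] bound nn[of "u - (a s / \<Gamma>) *\<^sub>R G (Y s) - xs"] by linarith
  qed (use M in simp)
  have "continuous_on {0..1} (\<lambda>s. norm (G (Y s)))"
  proof -
    have "continuous_on {0..1} a"
      unfolding a_def by (intro continuous_intros)
    moreover have "1 + a s \<noteq> 0" if "s \<in> {0..1}" for s using a0[of s] that by auto
    ultimately have "continuous_on {0..1} Y"
      unfolding Y_def by (intro continuous_intros) auto
    then show ?thesis
      using YX by (intro continuous_on_norm continuous_on_compose2[OF continuous_on_G]) auto
  qed
  moreover have "Y 0 = y" by (simp add: Y_def a_def)
  \<comment> \<open>Otherwise some \<open>Y s\<close> would attain the value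
    \<open>min (norm (G (Y 1))) (3 / 2 * M)\<close>, which exceeds \<open>M\<close>, against
    \<open>imp\<close>.\<close>
  ultimately have "norm (G (Y 1)) \<le> M"
    using IVT'[of "\<lambda>s. norm (G (Y s))" 0 "min (norm (G (Y 1))) (3 / 2 * M)" 1] imp Gy M
    by (fastforce simp: min_def split: if_splits)
  moreover have Y1: "Y 1 = y'" "a 1 = \<alpha>"
    by (simp_all add: Y_def y'_def a_def \<alpha>_def)
  ultimately have *: "(1 + \<alpha>) * (F y' - F xs) + \<Gamma> / 2 * (norm (u - (\<alpha> / \<Gamma>) *\<^sub>R G y' - xs))\<^sup>2
      \<le> F y - F xs + \<Gamma> / 2 * (norm (u - xs))\<^sup>2"
    using step[of 1] M by simp
  show "y' \<in> X" using YX[of 1] Y1 by simp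
  have xs: "xs \<in> closure X" using xs_X closure_subset by auto
  then show "u' \<in> closure X"
    unfolding u'_def by (intro Proj_closest(1)[OF _ _ closure_X_Rn]) auto
  have "dist u' xs \<le> dist (u - (\<alpha> / \<Gamma>) *\<^sub>R G y') xs"
    unfolding u'_def
    by (intro dist_Proj_le[OF _ _ closure_X_Rn xs] convex_closure convex_X) auto
  then have "(norm (u' - xs))\<^sup>2 \<le> (norm (u - (\<alpha> / \<Gamma>) *\<^sub>R G y' - xs))\<^sup>2"
    by (simp add: dist_norm power_mono)
  then have "\<Gamma> / 2 * (norm (u' - xs))\<^sup>2 \<le> \<Gamma> / 2 * (norm (u - (\<alpha> / \<Gamma>) *\<^sub>R G y' - xs))\<^sup>2"
    using \<Gamma> by (intro mult_left_mono) auto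
  with * show "(1 + \<alpha>) * (F y' - F xs) + \<Gamma> / 2 * (norm (u' - xs))\<^sup>2
      \<le> F y - F xs + \<Gamma> / 2 * (norm (u - xs))\<^sup>2" by linarith
qed

section \<open>The iterates and the number of gradient calls\<close>

lemma eps_solution_iff:
  assumes "x \<in> X"
  shows "eps_solution d f \<epsilon> x \<longleftrightarrow> F x - F xs \<le> \<epsilon>"
proof -
  have "(INF z\<in>Rn d. f z) = f xs"
    using xs_Rn xs_min by (intro antisym INF_lower INF_greatest) auto
  moreover have "f x - f xs = ereal (F x - F xs)"
    using f_eq[OF assms] f_eq[OF xs_X] by (metis ereal_minus(1))
  ultimately show ?thesis
    using X_Rn[OF assms] by (simp add: eps_solution_def)
qed

context
  fixes x0 :: evec and \<Gamma>0 Rb :: real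
  assumes x0: "x0 \<in> X" "x0 \<noteq> xs" and \<Gamma>0: "\<Gamma>0 > 0"
    and \<Gamma>0_ge: "\<Gamma>0 \<ge> 2 * (F x0 - F xs) / (norm (x0 - xs))\<^sup>2"
    and Rb: "Rb \<ge> norm (x0 - xs)"
begin

abbreviation R where "R \<equiv> norm (x0 - xs)"
abbreviation y where "y \<equiv> alg2_y d f ell \<Gamma>0 Rb x0"
definition u where "u k = fst (snd (alg2 d f ell \<Gamma>0 Rb x0 k))"
definition \<Gamma> where "\<Gamma> k = snd (snd (alg2 d f ell \<Gamma>0 Rb x0 k))"
definition \<gamma> where "\<gamma> k = 1 / ell (4 * psi_inv ell (\<Gamma> k * Rb\<^sup>2))"
definition \<alpha> where "\<alpha> k = sqrt (\<gamma> k * \<Gamma> k)"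

lemma alg2_0: "y 0 = x0" "u 0 = x0" "\<Gamma> 0 = \<Gamma>0"
  by (simp_all add: alg2_y_def u_def \<Gamma>_def)

lemma alg2_Suc:
  "y (Suc k) = (1 / (1 + \<alpha> k)) *\<^sub>R y k + (\<alpha> k / (1 + \<alpha> k)) *\<^sub>R u k
    - (\<gamma> k / (1 + \<alpha> k)) *\<^sub>R G (y k)"
  "u (Suc k) = Proj (closure X) (u k - (\<alpha> k / \<Gamma> k) *\<^sub>R G (y (Suc k)))"
  "\<Gamma> (Suc k) = \<Gamma> k / (1 + \<alpha> k)"
  by (simp_all add: alg2_y_def u_def \<Gamma>_def \<alpha>_def \<gamma>_def Let_def split_beta)

text \<open>At 0 the lower bound on \<open>\<Gamma>0\<close> covers the function gap with half of
  the right-hand side, and the distance term is the other half. In the step, multiplying by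
  \<open>1 + \<alpha> k\<close> reduces the claim to \<open>accelerated_step\<close>. Membership in
  \<open>X\<close> makes every gradient call legitimate.\<close>

lemma alg2_invariant:
  "y k \<in> X \<and> u k \<in> closure X \<and> \<Gamma> k > 0 \<and>
    F (y k) - F xs + \<Gamma> k / 2 * (norm (u k - xs))\<^sup>2 \<le> \<Gamma> k * R\<^sup>2"
proof (induction k)
  case 0
  have "2 * (F x0 - F xs) \<le> \<Gamma>0 * R\<^sup>2"
    using \<Gamma>0_ge x0 by (simp add: divide_le_eq)
  then show ?case
    using x0 \<Gamma>0 closure_subset[of X] by (auto simp: alg2_0)
next
  case (Suc k)
  define M where "M = psi_inv ell (\<Gamma> k * Rb\<^sup>2)"
  have Rpos: "R > 0" "Rb > 0" using x0 Rb by (simp_all add: less_le_trans[OF _ Rb])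
  then have t: "\<Gamma> k * Rb\<^sup>2 > 0" using Suc by simp
  have M: "M > 0" "psi ell M = \<Gamma> k * Rb\<^sup>2"
    using psi_inv[OF L0 L1 t] by (simp_all add: M_def)
  \<comment> \<open>The step size sees only \<open>Rb\<close>; as \<open>Rb\<close> is at least
    \<open>R\<close>, \<open>psi ell M\<close> still dominates the Lyapunov function.\<close>
  have "R\<^sup>2 \<le> Rb\<^sup>2" using Rb by (intro power_mono) auto
  then have "\<Gamma> k * R\<^sup>2 \<le> psi ell M" using Suc M by (simp add: mult_left_mono)
  then have bound: "F (y k) - F xs + \<Gamma> k / 2 * (norm (u k - xs))\<^sup>2 \<le> psi ell M"
    using Suc by linarith
  have yX: "y k \<in> X" and uX: "u k \<in> closure X" and \<Gamma>pos: "\<Gamma> k > 0" using Suc by auto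
  have "\<gamma> k = 1 / ell (4 * M)" by (simp add: \<gamma>_def M_def)
  note step = accelerated_step[OF yX uX M(1) \<Gamma>pos bound, folded this, folded \<alpha>_def,
      folded alg2_Suc(1), folded alg2_Suc(2)]
  have a: "1 + \<alpha> k > 0"
    using M L1 L0 \<Gamma>pos by (auto simp: \<alpha>_def \<open>\<gamma> k = _\<close> intro!: add_pos_nonneg)
  have \<Gamma>_Suc: "(1 + \<alpha> k) * \<Gamma> (Suc k) = \<Gamma> k"
    using a by (simp add: alg2_Suc(3))
  have "(1 + \<alpha> k) * (F (y (Suc k)) - F xs + \<Gamma> (Suc k) / 2 * (norm (u (Suc k) - xs))\<^sup>2) =
      (1 + \<alpha> k) * (F (y (Suc k)) - F xs) + \<Gamma> k / 2 * (norm (u (Suc k) - xs))\<^sup>2"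
    unfolding \<Gamma>_Suc[symmetric] by (simp add: algebra_simps)
  also have "\<dots> \<le> \<Gamma> k * R\<^sup>2" using step(3) Suc by linarith
  also have "\<dots> = (1 + \<alpha> k) * (\<Gamma> (Suc k) * R\<^sup>2)"
    unfolding \<Gamma>_Suc[symmetric] by simp
  finally have "F (y (Suc k)) - F xs + \<Gamma> (Suc k) / 2 * (norm (u (Suc k) - xs))\<^sup>2 \<le> \<Gamma> (Suc k) * R\<^sup>2"
    using a by simp
  then show ?case
    using step(1,2) \<Gamma>pos a by (simp add: alg2_Suc(3))
qed

lemma alg2_gap: "F (y k) - F xs \<le> \<Gamma> k * R\<^sup>2"
proof -
  have "0 \<le> \<Gamma> k / 2 * (norm (u k - xs))\<^sup>2" using alg2_invariant[of k] by simp
  then show ?thesis using alg2_invariant[of k] by linarith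
qed

lemma complexity:
  assumes \<epsilon>: "\<epsilon> > 0"
  shows "\<exists>N. real N \<le> 44 * (sqrt L0 * R / sqrt \<epsilon>
      + max (L1 * Rb * ln (min (L1\<^sup>2 * Rb\<^sup>2 * \<Gamma>0 / L0) (\<Gamma>0 * R\<^sup>2 / \<epsilon>))) 0
      + max (ln (\<Gamma>0 / L0)) 0) \<and>
    solves_with_calls d f ell \<Gamma>0 Rb x0 \<epsilon> N" (is "\<exists>N. real N \<le> 44 * ?D \<and> _")
proof -
  have R: "R > 0" "Rb > 0" using x0 Rb by (simp_all add: less_le_trans[OF _ Rb])
  have solves: "solves_with_calls d f ell \<Gamma>0 Rb x0 \<epsilon> N" if "F (y N) - F xs \<le> \<epsilon>" for N
    unfolding solves_with_calls_def using alg2_invariant that by (simp add: eps_solution_iff)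
  define E where "E = \<epsilon> / R\<^sup>2"
  have E: "E > 0" using \<epsilon> R by (simp add: E_def)
  have D: "?D = sqrt (L0 / E) + max (L1 * Rb * ln (min ((L1 * Rb)\<^sup>2 * \<Gamma>0 / L0) (\<Gamma>0 / E))) 0
      + max (ln (\<Gamma>0 / L0)) 0"
    by (simp add: E_def real_sqrt_divide real_sqrt_mult power_mult_distrib)
  have D0: "0 \<le> ?D" using L0 E unfolding D by simp
  have \<Gamma>_pos: "\<Gamma> k > 0" for k using alg2_invariant by blast
  show ?thesis
  \<comment> \<open>If \<open>x0\<close> is already good enough, no call is made. Otherwise the
    lower bound on \<open>\<Gamma>0\<close> gives \<open>2 * E < \<Gamma>0\<close>, as
    \<open>log_terms_bound\<close> requires.\<close>
  proof (cases "F x0 - F xs \<le> \<epsilon>")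
    case True
    then show ?thesis using D0 solves[of 0] by (intro exI[of _ 0]) (simp add: alg2_0)
  next
    case False
    have rec: "\<exists>a\<ge>0. \<Gamma> (Suc k) = \<Gamma> k / (1 + a) \<and> 1 \<le> 7 * (sqrt (L0 / \<Gamma> k) + L1 * Rb) * a" for k
    proof -
      have *: "1 \<le> 7 * (sqrt (L0 / \<Gamma> k) + L1 * Rb) * \<alpha> k"
        using step_size_lower_bound[OF L0 L1 \<Gamma>_pos R(2)] by (simp add: \<alpha>_def \<gamma>_def)
      have "0 \<le> psi_inv ell (\<Gamma> k * Rb\<^sup>2)"
        using psi_inv(1)[OF L0 L1, of "\<Gamma> k * Rb\<^sup>2"] \<Gamma>_pos[of k] R by simp
      then have "0 \<le> \<alpha> k"
        using L0 L1 \<Gamma>_pos[of k] by (simp add: \<alpha>_def \<gamma>_def)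
      with * show ?thesis using alg2_Suc(3) by blast
    qed
    have "0 \<le> L1 * Rb" using L1 R by simp
    then obtain N where N: "\<Gamma> N \<le> E"
      "N = 0 \<or> real N \<le> 1 + 14 * sqrt (L0 / E) + 7 * (L1 * Rb + 1) * ln (\<Gamma> 0 / E)"
      using steps_bound[where \<Gamma> = \<Gamma> and B = "L1 * Rb", OF L0 _ \<Gamma>_pos rec E] by blast
    have "2 * (F x0 - F xs) \<le> \<Gamma>0 * R\<^sup>2"
      using \<Gamma>0_ge x0 by (simp add: divide_le_eq)
    then have "2 * E < \<Gamma>0" using False R by (simp add: E_def field_simps)
    then have "1 + 14 * sqrt (L0 / E) + 7 * (L1 * Rb + 1) * ln (\<Gamma> 0 / E) \<le> 44 * ?D"
      unfolding D alg2_0 by (rule log_terms_bound[OF L0 \<open>0 \<le> L1 * Rb\<close> E])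
    then have "real N \<le> 44 * ?D" using N(2) D0 by auto
    moreover have "F (y N) - F xs \<le> \<epsilon>"
      using alg2_gap[of N] mult_right_mono[OF N(1), of "R\<^sup>2"] R by (simp add: E_def)
    ultimately show ?thesis using solves by blast
  qed
qed

end

end

theorem theorem4p3:
  shows "\<exists>C::real. C > 0 \<and>
    (\<forall>(d::nat) (f :: evec \<Rightarrow> ereal) (L0::real) (L1::real) (ell :: real \<Rightarrow> real)
       (xs::evec) (x0::evec) (R::real) (\<Gamma>0::real) (Rb::real) (\<epsilon>::real).
      L0 > 0 \<longrightarrow> L1 \<ge> 0 \<longrightarrow> ell = (\<lambda>s. L0 + L1 * s) \<longrightarrow>
      proper_domain d f \<longrightarrow> ext_convex d f \<longrightarrow> ell_smooth d f ell \<longrightarrow>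
      xs \<in> Rn d \<longrightarrow> (\<forall>z\<in>Rn d. f xs \<le> f z) \<longrightarrow>
      x0 \<in> edomain d f \<longrightarrow> x0 \<noteq> xs \<longrightarrow> R = norm (x0 - xs) \<longrightarrow>
      \<Gamma>0 > 0 \<longrightarrow>
      \<Gamma>0 \<ge> 2 * (real_of_ereal (f x0) - real_of_ereal (f xs)) / (norm (x0 - xs))\<^sup>2 \<longrightarrow>
      Rb \<ge> R \<longrightarrow> \<epsilon> > 0 \<longrightarrow>
      (\<exists>N::nat.
         real N \<le> C * (sqrt L0 * R / sqrt \<epsilon>
           + max (L1 * Rb * ln (min (L1\<^sup>2 * Rb\<^sup>2 * \<Gamma>0 / L0) (\<Gamma>0 * R\<^sup>2 / \<epsilon>))) 0
           + max (ln (\<Gamma>0 / L0)) 0) \<and>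
         solves_with_calls d f ell \<Gamma>0 Rb x0 \<epsilon> N))"
proof (rule exI[of _ 44], intro conjI allI impI)
  fix d f ell xs x0 and L0 L1 R \<Gamma>0 Rb \<epsilon> :: real
  assume A: "L0 > 0" "L1 \<ge> 0" "ell = (\<lambda>s. L0 + L1 * s)"
    "proper_domain d f" "ext_convex d f" "ell_smooth d f ell"
    "xs \<in> Rn d" "\<forall>z\<in>Rn d. f xs \<le> f z" "x0 \<in> edomain d f" "x0 \<noteq> xs" "R = norm (x0 - xs)"
    "\<Gamma>0 > 0" "\<Gamma>0 \<ge> 2 * (real_of_ereal (f x0) - real_of_ereal (f xs)) / (norm (x0 - xs))\<^sup>2"
    "Rb \<ge> R" "\<epsilon> > 0"
  interpret L0L1_smooth_convex d f L0 L1 xs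
    using A by unfold_locales auto
  show "\<exists>N::nat.
         real N \<le> 44 * (sqrt L0 * R / sqrt \<epsilon>
           + max (L1 * Rb * ln (min (L1\<^sup>2 * Rb\<^sup>2 * \<Gamma>0 / L0) (\<Gamma>0 * R\<^sup>2 / \<epsilon>))) 0
           + max (ln (\<Gamma>0 / L0)) 0) \<and>
         solves_with_calls d f ell \<Gamma>0 Rb x0 \<epsilon> N"
    using complexity[of x0 \<Gamma>0 Rb \<epsilon>] A by simp
qed simp

end
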